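(* Let $\preceq$ be an order on $\mathbb{T}$ that is compatible with arithmetic operations, compatible with MIN-MAX operators, and satisfies the weak law of trichotomy (WLT). Then for each $t\in\mathbb{R}$ and all $(x_1,t,y_1),(x_2,t,y_2)\in\mathbb{T}$: (i) if $I_0\subseteq P_{\preceq}$, then $$(x_1,t,y_1)\preceq(x_2,t,y_2)\iff \big[x_1+y_1<x_2+y_2\big]\ \text{or}\ \big[x_1+y_1=x_2+y_2\ \text{and}\ y_1\le y_2\big];$$ (ii) if $I_0\cap P_{\preceq}=\emptyset$, then $$(x_1,t,y_1)\preceq(x_2,t,y_2)\iff \big[x_1+y_1<x_2+y_2\big]\ \text{or}\ \big[x_1+y_1=x_2+y_2\ \text{and}\ x_1\le x_2\big].$$
   Context: Triangular fuzzy numbers: $\mathbb{T}=\{(a_1,a,a_2)\in\mathbb{R}^3: a_1\le a\le a_2\}$. Each $t\in\mathbb{R}$ is identified with the scalar $(t,t,t)\in\mathbb{T}$; in particular $0=(0,0,0)$. Operations: $(a_1,a,a_2)+(b_1,b,b_2)=(a_1+b_1,a+b,a_2+b_2)$; for $t\in\mathbb{R}$, $t(a_1,a,a_2)=(ta_1,ta,ta_2)$ if $t\ge0$ and $(ta_2,ta,ta_1)$ if $t<0$; $-\alpha=(-1)\alpha$, $\alpha-\beta=\alpha+(-1)\beta$. An order on $\mathbb{T}$ means a total order $\preceq$ (total, reflexive, antisymmetric, transitive); $\alpha\prec\beta$ means $\alpha\preceq\beta$ and $\alpha\ne\beta$. $\le,<$ denote the usual order of $\mathbb{R}$. $P_{\preceq}=\{\alpha\in\mathbb{T}:0\prec\alpha\}$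 and $I_0=\{(-t,0,t): t\in\mathbb{R},\ t>0\}$ (the nonzero $\alpha$ with $\alpha=-\alpha$). Compatibility with arithmetic operations: $\alpha\preceq\beta$ implies $\alpha+\gamma\preceq\beta+\gamma$ for all $\gamma\in\mathbb{T}$, and $t\alpha\preceq t\beta$ for all real $t\ge0$. Compatibility with MIN-MAX operators: for all $\alpha,\beta\in\mathbb{T}$, if $MIN(\alpha,\beta)=\alpha$ then $\alpha\preceq\beta$. Here $\alpha=(a_1,a,a_2)$ is viewed as the membership function $\mathbb{R}\to[0,1]$ equal to $\frac{t-a_1}{a-a_1}$ on $[a_1,a)$, $1$ at $a$, $\frac{a_2-t}{a_2-a}$ on $(a,a_2]$, and $0$ elsewhere, and $MIN(\alpha,\beta)(z)=\sup_{z=\min\{x,y\}}\min\{\alpha(x),\beta(y)\}$. Equivalently (well known), for $\alpha=(a_1,a,a_2)$, $\beta=(b_1,b,b_2)$, $MIN(\alpha,\beta)=\alpha$ if and only if $a_1\le b_1$, $a\le b$ and $a_2\le b_2$. WLT: for every $\alpha\in\mathbb{T}\setminus I_0$, exactly one of the following holds: $\alpha=0$, $0\prec\alpha$, $0\prec-\alpha$. *)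

theory Defs
  imports Complex_Main "HOL-Library.Product_Plus"
begin

text \<open>
  The triangular fuzzy numbers form a subset of \<open>real \<times> real \<times> real\<close>. Their addition and
  their zero are the componentwise ones of the product type. Scalar multiplication and negation
  are not componentwise: for a triangular fuzzy number \<open>\<alpha>\<close>, the element \<open>-\<alpha>\<close> is \<open>fneg \<alpha>\<close>, and
  never the \<open>uminus\<close> of the product type.
\<close>

type_synonym triple = "real \<times> real \<times> real"

definition TFN :: "triple set" where
  "TFN = {(a1, a, a2). a1 \<le> a \<and> a \<le> a2}"

fun fscale :: "real \<Rightarrow> triple \<Rightarrow> triple" where
  "fscale t (a1, a, a2) =
     (if t \<ge> 0 then (t * a1, t * a, t * a2) else (t * a2, t * a, t * a1))"

definition fneg :: "triple \<Rightarrow> triple" where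
  "fneg \<alpha> = fscale (-1) \<alpha>"

fun membership :: "triple \<Rightarrow> real \<Rightarrow> real" where
  "membership (a1, a, a2) t =
     (if a1 \<le> t \<and> t < a then (t - a1) / (a - a1)
      else if t = a then 1
      else if a < t \<and> t \<le> a2 then (a2 - t) / (a2 - a)
      else 0)"

text \<open>
  The supremum below is taken over a nonempty set of reals, which is bounded whenever the two
  functions take values in \<open>[0, 1]\<close>.
\<close>

definition fuzzy_MIN :: "(real \<Rightarrow> real) \<Rightarrow> (real \<Rightarrow> real) \<Rightarrow> real \<Rightarrow> real" where
  "fuzzy_MIN f g z = Sup {min (f x) (g y) |x y. z = min x y}"

text \<open>Only the restriction of the relation \<open>le\<close> to \<open>TFN\<close> matters in the following definitions.\<close>

definition order_on_TFN :: "(triple \<Rightarrow> triple \<Rightarrow> bool) \<Rightarrow> bool" where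
  "order_on_TFN le \<longleftrightarrow>
     reflp_on TFN le \<and> antisymp_on TFN le \<and> transp_on TFN le \<and> totalp_on TFN le"

definition strict :: "(triple \<Rightarrow> triple \<Rightarrow> bool) \<Rightarrow> triple \<Rightarrow> triple \<Rightarrow> bool" where
  "strict le \<alpha> \<beta> \<longleftrightarrow> le \<alpha> \<beta> \<and> \<alpha> \<noteq> \<beta>"

definition positives :: "(triple \<Rightarrow> triple \<Rightarrow> bool) \<Rightarrow> triple set" where
  "positives le = {\<alpha> \<in> TFN. strict le 0 \<alpha>}"

definition I0 :: "triple set" where
  "I0 = {(- t, 0, t) |t. t > 0}"

definition arith_compatible :: "(triple \<Rightarrow> triple \<Rightarrow> bool) \<Rightarrow> bool" where
  "arith_compatible le \<longleftrightarrow>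
     (\<forall>\<alpha>\<in>TFN. \<forall>\<beta>\<in>TFN. le \<alpha> \<beta> \<longrightarrow>
        (\<forall>\<gamma>\<in>TFN. le (\<alpha> + \<gamma>) (\<beta> + \<gamma>)) \<and>
        (\<forall>t\<ge>0. le (fscale t \<alpha>) (fscale t \<beta>)))"

definition min_max_compatible :: "(triple \<Rightarrow> triple \<Rightarrow> bool) \<Rightarrow> bool" where
  "min_max_compatible le \<longleftrightarrow>
     (\<forall>\<alpha>\<in>TFN. \<forall>\<beta>\<in>TFN.
        fuzzy_MIN (membership \<alpha>) (membership \<beta>) = membership \<alpha> \<longrightarrow> le \<alpha> \<beta>)"

definition exactly_one :: "bool \<Rightarrow> bool \<Rightarrow> bool \<Rightarrow> bool" where
  "exactly_one A B C \<longleftrightarrow>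
     (A \<and> \<not> B \<and> \<not> C) \<or> (\<not> A \<and> B \<and> \<not> C) \<or> (\<not> A \<and> \<not> B \<and> C)"

definition weak_trichotomy :: "(triple \<Rightarrow> triple \<Rightarrow> bool) \<Rightarrow> bool" where
  "weak_trichotomy le \<longleftrightarrow>
     (\<forall>\<alpha>\<in>TFN - I0. exactly_one (\<alpha> = 0) (strict le 0 \<alpha>) (strict le 0 (fneg \<alpha>)))"

end

theory Submission
  imports Defs
begin

text \<open>
  Totality makes addition order-cancellative, so whether \<open>\<alpha> \<preceq> \<beta>\<close> holds depends only on the
  difference vector of \<open>\<alpha>\<close> and \<open>\<beta>\<close>; for a common centre it has the form \<open>(p, 0, q)\<close>. Fuzzy
  negation sends \<open>(-x, 0, y)\<close> to \<open>(-y, 0, x)\<close>. For \<open>x < y\<close> the latter is componentwise below the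
  former, so if the latter were positive, both would be, against the weak trichotomy. Hence the
  sign of \<open>p + q\<close> decides; if \<open>p + q = 0\<close>, the difference or its negative lies in \<open>I0\<close>.
\<close>

section \<open>Membership functions and the MIN operator\<close>

lemma membership_nonneg: "(a1, a, a2) \<in> TFN \<Longrightarrow> 0 \<le> membership (a1, a, a2) t"
  by (auto simp: TFN_def)

lemma membership_le_1: "(a1, a, a2) \<in> TFN \<Longrightarrow> membership (a1, a, a2) t \<le> 1"
  by (auto simp: TFN_def divide_simps)

lemma membership_antimono_right:
  assumes "(a1, a, a2) \<in> TFN" "a \<le> z" "z \<le> x"
  shows "membership (a1, a, a2) x \<le> membership (a1, a, a2) z"
  using assms by (auto simp: TFN_def intro: divide_right_mono)

text \<open>The apex and then the foot of a rising edge move left, via the edge from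
  \<open>b1\<close> to \<open>a\<close>; neither move lowers the value at \<open>z\<close>.\<close>

lemma frac_left_le:
  fixes z :: real
  assumes "a1 \<le> b1" "a \<le> b" "b1 \<le> z" "z < a"
  shows "(z - b1) / (b - b1) \<le> (z - a1) / (a - a1)"
proof -
  have "(z - b1) / (b - b1) \<le> (z - b1) / (a - b1)"
    using assms by (intro divide_left_mono) auto
  \<comment> \<open>In this form the foot occurs in the denominator only.\<close>
  also have "\<dots> = 1 - (a - z) / (a - b1)"
    using assms by (simp add: field_simps)
  also have "\<dots> \<le> 1 - (a - z) / (a - a1)"
    using assms by (auto intro!: divide_left_mono)
  also have "\<dots> = (z - a1) / (a - a1)"
    using assms by (simp add: field_simps)
  finally show ?thesis .
qed

lemma membership_left_le:
  assumes "(a1, a, a2) \<in> TFN" "(b1, b, b2) \<in> TFN" "a1 \<le> b1" "a \<le> b" "z \<le> a"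
  shows "membership (b1, b, b2) z \<le> membership (a1, a, a2) z"
proof (cases "z = a \<or> z < b1")
  \<comment> \<open>The first function is 1 at its apex \<open>a\<close>, the second vanishes left
    of its foot \<open>b1\<close>.\<close>
  case True
  then show ?thesis
    using assms membership_le_1[OF assms(2), of z] membership_nonneg[OF assms(1), of z]
    by (auto simp: TFN_def)
next
  case False
  with assms show ?thesis
    using frac_left_le[of a1 b1 a b z] by auto
qed

text \<open>Fuzzy negation mirrors the graph in the origin, so facts about rising edges transfer to
  falling ones.\<close>

lemma membership_fneg: "(a1, a, a2) \<in> TFN \<Longrightarrow>
    membership (- a2, - a, - a1) (- z) = membership (a1, a, a2) z"
  by (auto simp: TFN_def)

lemma membership_right_le:
  assumes "(a1, a, a2) \<in> TFN" "(b1, b, b2) \<in> TFN" "a2 \<le> b2" "a \<le> b" "b \<le> z"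
  shows "membership (a1, a, a2) z \<le> membership (b1, b, b2) z"
proof -
  have "membership (- a2, - a, - a1) (- z) \<le> membership (- b2, - b, - b1) (- z)"
    using assms by (intro membership_left_le) (auto simp: TFN_def)
  then show ?thesis
    using assms by (simp only: membership_fneg)
qed

text \<open>The supremum is a maximum: one pair with minimum \<open>z\<close> yields
  \<open>?f z\<close>, and no pair yields more.\<close>

lemma fuzzy_MIN_eq_left:
  assumes A: "(a1, a, a2) \<in> TFN" and B: "(b1, b, b2) \<in> TFN"
    and le: "a1 \<le> b1" "a \<le> b" "a2 \<le> b2"
  shows "fuzzy_MIN (membership (a1, a, a2)) (membership (b1, b, b2)) = membership (a1, a, a2)"
proof
  fix z
  let ?f = "membership (a1, a, a2)" and ?g = "membership (b1, b, b2)"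
  let ?S = "{min (?f x) (?g y) |x y. z = min x y}"
  \<comment> \<open>The witness for \<open>y\<close> is the apex \<open>b\<close>, where
    \<open>?g\<close> is 1, or \<open>z\<close> itself once \<open>z\<close> is on the falling edge
    side.\<close>
  have "?f z \<le> ?g (max z b)"
    using membership_right_le[OF A B le(3,2), of z] membership_le_1[OF A, of z]
    by (cases "z \<le> b") (auto simp: max_def)
  then have "?f z = min (?f z) (?g (max z b))"
    by simp
  moreover have "z = min z (max z b)"
    by simp
  ultimately have "?f z \<in> ?S"
    by blast
  moreover have "min (?f x) (?g y) \<le> ?f z" if "z = min x y" for x y
  proof (cases "z = x")
    case True
    then show ?thesis by simp
  next
    case False
    with that have z: "z = y" "z \<le> x"
      by (auto simp: min_def split: if_splits)
    \<comment> \<open>Up to the apex \<open>a\<close>, \<open>?g z\<close> is at most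
      \<open>?f z\<close>; beyond it \<open>?f\<close> does not increase, so \<open>?f x\<close> is
      at most \<open>?f z\<close>.\<close>
    show ?thesis
    proof (cases "z \<le> a")
      case True
      then show ?thesis
        using membership_left_le[OF A B le(1,2) True] z by (simp only: min.coboundedI2)
    next
      case False
      then have "?f x \<le> ?f z"
        using membership_antimono_right[OF A, of z x] z by linarith
      then show ?thesis
        by (simp only: min.coboundedI1)
    qed
  qed
  ultimately show "fuzzy_MIN ?f ?g z = ?f z"
    unfolding fuzzy_MIN_def by (intro cSup_eq_maximum) blast+
qed

section \<open>Signs of triples with centre 0\<close>

locale TFN_order =
  fixes le :: "triple \<Rightarrow> triple \<Rightarrow> bool" (infix "\<preceq>" 50)
  assumes order: "order_on_TFN (\<preceq>)"
    and arith: "arith_compatible (\<preceq>)"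
    and min_max: "min_max_compatible (\<preceq>)"
    and wlt: "weak_trichotomy (\<preceq>)"
begin

lemma refl: "\<alpha> \<in> TFN \<Longrightarrow> \<alpha> \<preceq> \<alpha>"
  using order by (auto simp: order_on_TFN_def dest: reflp_onD)

lemma antisym: "\<lbrakk>\<alpha> \<preceq> \<beta>; \<beta> \<preceq> \<alpha>; \<alpha> \<in> TFN; \<beta> \<in> TFN\<rbrakk> \<Longrightarrow> \<alpha> = \<beta>"
  using order by (auto simp: order_on_TFN_def dest: antisymp_onD)

lemma trans: "\<lbrakk>\<alpha> \<preceq> \<beta>; \<beta> \<preceq> \<gamma>; \<alpha> \<in> TFN; \<beta> \<in> TFN; \<gamma> \<in> TFN\<rbrakk> \<Longrightarrow> \<alpha> \<preceq> \<gamma>"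
  using order unfolding order_on_TFN_def by (blast dest: transp_onD)

lemma total: "\<lbrakk>\<alpha> \<in> TFN; \<beta> \<in> TFN\<rbrakk> \<Longrightarrow> \<alpha> \<preceq> \<beta> \<or> \<beta> \<preceq> \<alpha>"
  using order refl unfolding order_on_TFN_def by (metis totalp_onD)

lemma add_right_mono: "\<lbrakk>\<alpha> \<preceq> \<beta>; \<alpha> \<in> TFN; \<beta> \<in> TFN; \<gamma> \<in> TFN\<rbrakk> \<Longrightarrow> \<alpha> + \<gamma> \<preceq> \<beta> + \<gamma>"
  using arith by (auto simp: arith_compatible_def)

text \<open>MIN-MAX compatibility enters here only; the rest works with endpoints.\<close>

lemma componentwise_imp_le:
  "\<lbrakk>(a1, a, a2) \<in> TFN; (b1, b, b2) \<in> TFN; a1 \<le> b1; a \<le> b; a2 \<le> b2\<rbrakk>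
    \<Longrightarrow> (a1, a, a2) \<preceq> (b1, b, b2)"
  using min_max fuzzy_MIN_eq_left by (simp add: min_max_compatible_def)

lemma zero_in_TFN: "0 \<in> TFN"
  by (simp add: TFN_def zero_prod_def)

lemma zero_le_of_pos_sum:
  assumes "0 \<le> x" "x < y"
  shows "0 \<preceq> (- x, 0, y)"
proof (rule ccontr)
  let ?\<alpha> = "(- x, 0, y)"
  have mem: "?\<alpha> \<in> TFN" "fneg ?\<alpha> \<in> TFN" and notin: "?\<alpha> \<notin> I0"
    and nz: "?\<alpha> \<noteq> 0"
    using assms by (auto simp: TFN_def fneg_def I0_def zero_prod_def)
  assume neg: "\<not> 0 \<preceq> ?\<alpha>"
  with wlt mem notin nz have "0 \<preceq> fneg ?\<alpha>"
    unfolding weak_trichotomy_def exactly_one_def strict_def by blast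
  moreover have "fneg ?\<alpha> \<preceq> ?\<alpha>"
    using assms mem by (auto simp: fneg_def intro!: componentwise_imp_le)
  ultimately show False
    using neg trans mem zero_in_TFN by blast
qed

lemma le_zero_of_neg_sum:
  assumes "0 \<le> y" "y < x"
  shows "(- x, 0, y) \<preceq> 0"
proof (rule ccontr)
  let ?\<alpha> = "(- x, 0, y)"
  have mem: "?\<alpha> \<in> TFN" and notin: "?\<alpha> \<notin> I0" and nz: "?\<alpha> \<noteq> 0" "fneg ?\<alpha> \<noteq> 0"
    using assms by (auto simp: TFN_def fneg_def I0_def zero_prod_def)
  assume "\<not> ?\<alpha> \<preceq> 0"
  then have "0 \<preceq> ?\<alpha>"
    using total mem zero_in_TFN by blast
  \<comment> \<open>\<open>fneg ?\<alpha>\<close> is \<open>(- y, 0, x)\<close>, so the roles of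
    \<open>x\<close> and \<open>y\<close> are exchanged.\<close>
  moreover have "0 \<preceq> fneg ?\<alpha>"
    using zero_le_of_pos_sum[OF assms] by (simp add: fneg_def)
  ultimately show False
    using wlt mem notin nz unfolding weak_trichotomy_def exactly_one_def strict_def by auto
qed

section \<open>From signs of differences to the order\<close>

lemma le_add: "\<lbrakk>0 \<preceq> \<delta>; \<delta> \<in> TFN; \<alpha> \<in> TFN\<rbrakk> \<Longrightarrow> \<alpha> \<preceq> \<delta> + \<alpha>"
  using add_right_mono[of 0 \<delta> \<alpha>] zero_in_TFN by simp

lemma add_le: "\<lbrakk>\<delta> \<preceq> 0; \<delta> \<in> TFN; \<alpha> \<in> TFN\<rbrakk> \<Longrightarrow> \<delta> + \<alpha> \<preceq> \<alpha>"
  using add_right_mono[of \<delta> 0 \<alpha>] zero_in_TFN by simp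

text \<open>Unless the triples are ordered componentwise, one of their two componentwise (not fuzzy)
  differences is itself in \<open>TFN\<close>, with a known sign.\<close>

lemma le_of_sum_less:
  assumes A: "(x1, t, y1) \<in> TFN" and B: "(x2, t, y2) \<in> TFN" and less: "x1 + y1 < x2 + y2"
  shows "(x1, t, y1) \<preceq> (x2, t, y2)"
proof -
  consider "x1 \<le> x2" "y1 \<le> y2" | "x2 < x1" | "y2 < y1"
    by linarith
  then show ?thesis
  proof cases
    case 1
    then show ?thesis
      using A B by (auto intro: componentwise_imp_le)
  next
    case 2
    let ?\<delta> = "(- (x1 - x2), 0, y2 - y1)"
    have "?\<delta> \<in> TFN" "0 \<preceq> ?\<delta>"
      \<comment> \<open>Without the deletion, the simplifier would destroy the shape
        \<open>(- x, 0, y)\<close>.\<close>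
      using 2 less by (auto simp: TFN_def simp del: minus_diff_eq intro!: zero_le_of_pos_sum)
    from le_add[OF this(2,1) A] show ?thesis
      by simp
  next
    case 3
    let ?\<delta> = "(- (x2 - x1), 0, y1 - y2)"
    have "?\<delta> \<in> TFN" "?\<delta> \<preceq> 0"
      using 3 less by (auto simp: TFN_def simp del: minus_diff_eq intro!: le_zero_of_neg_sum)
    from add_le[OF this(2,1) B] show ?thesis
      by simp
  qed
qed

text \<open>The tie rule stays a parameter \<open>P\<close>, to serve both sign choices for
  \<open>I0\<close>.\<close>

lemma le_iff_lex:
  assumes A: "(x1, t, y1) \<in> TFN" and B: "(x2, t, y2) \<in> TFN"
    and tie: "x1 + y1 = x2 + y2 \<Longrightarrow> (x1, t, y1) \<preceq> (x2, t, y2) \<longleftrightarrow> P"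
  shows "(x1, t, y1) \<preceq> (x2, t, y2) \<longleftrightarrow> x1 + y1 < x2 + y2 \<or> (x1 + y1 = x2 + y2 \<and> P)"
proof (cases "x2 + y2 < x1 + y1")
  case True
  then show ?thesis
    using le_of_sum_less[OF B A] antisym A B by fastforce
next
  case False
  then show ?thesis
    using le_of_sum_less[OF A B] tie by linarith
qed

text \<open>At equal sums the right triple is the left one widened by an element of
  \<open>I0\<close>, which is positive here.\<close>

lemma le_of_upper_less:
  assumes pos: "I0 \<subseteq> positives (\<preceq>)"
    and A: "(x1, t, y1) \<in> TFN" and eq: "x1 + y1 = x2 + y2" and less: "y1 < y2"
  shows "(x1, t, y1) \<preceq> (x2, t, y2)"
proof -
  let ?\<delta> = "(- (y2 - y1), 0, y2 - y1)"
  have "?\<delta> \<in> I0"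
    using less unfolding I0_def by fastforce
  then have "?\<delta> \<in> TFN" "0 \<preceq> ?\<delta>"
    using pos by (auto simp: positives_def strict_def)
  moreover have "?\<delta> + (x1, t, y1) = (x2, t, y2)"
    using eq by simp
  ultimately show ?thesis
    using le_add A by metis
qed

text \<open>Now the left triple is the wider one, and widening by an element of \<open>I0\<close>
  lowers a triple.\<close>

lemma le_of_lower_less:
  assumes nonpos: "I0 \<inter> positives (\<preceq>) = {}"
    and B: "(x2, t, y2) \<in> TFN" and eq: "x1 + y1 = x2 + y2" and less: "x1 < x2"
  shows "(x1, t, y1) \<preceq> (x2, t, y2)"
proof -
  let ?\<delta> = "(- (x2 - x1), 0, x2 - x1)"
  have "?\<delta> \<in> I0"
    using less unfolding I0_def by fastforce
  moreover have mem: "?\<delta> \<in> TFN" and "?\<delta> \<noteq> 0"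
    using less by (auto simp: TFN_def zero_prod_def)
  ultimately have "\<not> 0 \<preceq> ?\<delta>"
    using nonpos by (auto simp: positives_def strict_def)
  \<comment> \<open>WLT is silent on \<open>I0\<close>; totality decides.\<close>
  then have "?\<delta> \<preceq> 0"
    using total mem zero_in_TFN by blast
  moreover have "?\<delta> + (x2, t, y2) = (x1, t, y1)"
    using eq by simp
  ultimately show ?thesis
    using add_le mem B by metis
qed

lemma tie_upper:
  assumes pos: "I0 \<subseteq> positives (\<preceq>)"
    and A: "(x1, t, y1) \<in> TFN" and B: "(x2, t, y2) \<in> TFN" and eq: "x1 + y1 = x2 + y2"
  shows "(x1, t, y1) \<preceq> (x2, t, y2) \<longleftrightarrow> y1 \<le> y2"
proof (cases y1 y2 rule: linorder_cases)
  case less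
  then show ?thesis using le_of_upper_less[OF pos A eq] by simp
next
  case equal
  then show ?thesis using refl A eq by simp
next
  case greater
  \<comment> \<open>With the triples exchanged, antisymmetry would force
    \<open>y1 = y2\<close>.\<close>
  then show ?thesis using le_of_upper_less[OF pos B eq[symmetric]] antisym A B by fastforce
qed

lemma tie_lower:
  assumes nonpos: "I0 \<inter> positives (\<preceq>) = {}"
    and A: "(x1, t, y1) \<in> TFN" and B: "(x2, t, y2) \<in> TFN" and eq: "x1 + y1 = x2 + y2"
  shows "(x1, t, y1) \<preceq> (x2, t, y2) \<longleftrightarrow> x1 \<le> x2"
proof (cases x1 x2 rule: linorder_cases)
  case less
  then show ?thesis using le_of_lower_less[OF nonpos B eq] by simp
next
  case equal
  then show ?thesis using refl A eq by simp
next
  case greater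
  then show ?thesis using le_of_lower_less[OF nonpos A eq[symmetric]] antisym A B by fastforce
qed

end

theorem theorem1:
  fixes le :: "triple \<Rightarrow> triple \<Rightarrow> bool" (infix "\<preceq>" 50)
  assumes "order_on_TFN (\<preceq>)"
    and "arith_compatible (\<preceq>)"
    and "min_max_compatible (\<preceq>)"
    and "weak_trichotomy (\<preceq>)"
  shows
    "(I0 \<subseteq> positives (\<preceq>) \<longrightarrow>
       (\<forall>t x1 y1 x2 y2. (x1, t, y1) \<in> TFN \<longrightarrow> (x2, t, y2) \<in> TFN \<longrightarrow>
          ((x1, t, y1) \<preceq> (x2, t, y2) \<longleftrightarrow>
             x1 + y1 < x2 + y2 \<or> (x1 + y1 = x2 + y2 \<and> y1 \<le> y2)))) \<and>
     (I0 \<inter> positives (\<preceq>) = {} \<longrightarrow>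
       (\<forall>t x1 y1 x2 y2. (x1, t, y1) \<in> TFN \<longrightarrow> (x2, t, y2) \<in> TFN \<longrightarrow>
          ((x1, t, y1) \<preceq> (x2, t, y2) \<longleftrightarrow>
             x1 + y1 < x2 + y2 \<or> (x1 + y1 = x2 + y2 \<and> x1 \<le> x2))))"
proof -
  interpret TFN_order "(\<preceq>)"
    using assms by unfold_locales
  show ?thesis
    using le_iff_lex tie_upper tie_lower by simp
qed

end
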